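(* Let $n,k,m$ be integers with $n\ge 1$ and $k,m\ge 0$. Then $$\left|S^\circ(n,k,m)\right| = \begin{cases} 0 & \text{if } n+k+m \text{ is odd},\\ z(n,k,m)+z(n,k-1,m)+z(n,m,k)+z(n,m-1,k) & \text{if } n+k+m \text{ is even}.\end{cases}$$
   Context: A binary string of length $n$ is a sequence $b_1b_2\cdots b_n$ with each $b_i\in\{0,1\}$. A 0-pair (resp. 1-pair) of the string is an index $i$ with $1\le i\le n-1$ and $b_i=b_{i+1}=0$ (resp. $b_i=b_{i+1}=1$); the first and last bits are not considered consecutive. For integers $n\ge 0$ and $k,m\ge 0$, $Z(n,k,m)$ is the set of binary strings of length $n$ whose first bit is 0 and which have exactly $k$ 0-pairs and exactly $m$ 1-pairs, and $z(n,k,m)=|Z(n,k,m)|$ (so $z(0,k,m)=0$, since the empty string has no first bit). By convention $z(n,k,m)=0$ whenever $n<0$, $k<0$ or $m<0$. $S^\circ(n,k,m)$ is the set of all binary strings of length $n$ (starting with either bit) having exactly $k$ pairs of consecutive 0s and exactly $m$ pairs of consecutive 1s when the last and first bits are also considered consecutive: that is, in addition to the $n-1$ pairs $(b_i,b_{i+1})$, $1\le i\le n-1$, the pair $(b_n,b_1)$ is counted as one further pair of consecutive bits. Strings that are rotations of one another are counted as different. *)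

theory Defs
  imports Main
begin

definition binary_strings :: "nat \<Rightarrow> nat list set" where
  "binary_strings n = {b. length b = n \<and> set b \<subseteq> {0, 1}}"

definition pairs :: "nat \<Rightarrow> nat list \<Rightarrow> nat" where
  "pairs c b = card {i. Suc i < length b \<and> b ! i = c \<and> b ! Suc i = c}"

(* The wrap-around pair is one further pair even when n = 1, where it pairs the bit with
   itself, and when n = 2. *)
definition circular_pairs :: "nat \<Rightarrow> nat list \<Rightarrow> nat" where
  "circular_pairs c b =
     pairs c b + (if b \<noteq> [] \<and> last b = c \<and> hd b = c then 1 else 0)"

definition Z :: "nat \<Rightarrow> nat \<Rightarrow> nat \<Rightarrow> nat list set" where
  "Z n k m =
     {b \<in> binary_strings n. b \<noteq> [] \<and> hd b = 0 \<and> pairs 0 b = k \<and> pairs 1 b = m}"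

definition z :: "int \<Rightarrow> int \<Rightarrow> int \<Rightarrow> nat" where
  "z n k m =
     (if n < 0 \<or> k < 0 \<or> m < 0 then 0 else card (Z (nat n) (nat k) (nat m)))"

definition S_circ :: "nat \<Rightarrow> nat \<Rightarrow> nat \<Rightarrow> nat list set" where
  "S_circ n k m =
     {b \<in> binary_strings n. circular_pairs 0 b = k \<and> circular_pairs 1 b = m}"

end

theory Submission
  imports Defs
begin

text \<open>
  Read cyclically, a string of length \<open>n \<ge> 1\<close> has \<open>n\<close> adjacent pairs, and the pairs of distinct
  bits among them are even in number, since one returns to the bit one started from. Hence
  \<open>n + k + m\<close> is even whenever \<open>S_circ n k m\<close> is inhabited.

  Let \<open>n + k + m\<close> be even. The linear form of the same parity count (\<open>hd_eq_last_iff\<close>) shows that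
  the last bit is determined by the first bit and the numbers of linear pairs. A string in
  \<open>S_circ n k m\<close> with first bit 0 therefore falls into one of two classes: if it ends in 1, the
  wrap-around pair counts for nothing and the string lies in \<open>Z n k m\<close>; if it ends in 0, the
  wrap-around pair is a 0-pair and the string lies in \<open>Z n (k - 1) m\<close>. Conversely parity forces
  every string of \<open>Z n k m\<close> to end in 1 and every string of \<open>Z n (k - 1) m\<close> to end in 0, so no
  condition on the last bit is left (\<open>card_S_circ_hd_0\<close>). Strings with first bit 1 are handled by
  complementing all bits, which exchanges \<open>k\<close> and \<open>m\<close> (\<open>card_S_circ_hd_1\<close>).
\<close>

lemma pairs_singleton [simp]: "pairs c [x] = 0"
  by (simp add: pairs_def)

lemma pairs_Cons_Cons [simp]:
  "pairs c (x # y # xs) = (if x = c \<and> y = c then 1 else 0) + pairs c (y # xs)"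
proof -
  let ?P = "\<lambda>b. {i. Suc i < length b \<and> b ! i = c \<and> b ! Suc i = c}"
  have fin: "finite (?P (y # xs))"
    by (rule finite_subset[of _ "{..<length (y # xs)}"]) auto
  have split: "?P (x # y # xs) = (if x = c \<and> y = c then {0} else {}) \<union> Suc ` ?P (y # xs)"
    (is "?L = ?R")
  proof (rule set_eqI)
    fix i show "i \<in> ?L \<longleftrightarrow> i \<in> ?R" by (cases i) auto
  qed
  have "card ?R = card (if x = c \<and> y = c then {0::nat} else {}) + card (Suc ` ?P (y # xs))"
    by (rule card_Un_disjoint) (use fin in auto)
  then show ?thesis
    unfolding pairs_def split by (simp add: card_image)
qed

text \<open>
  Of the \<open>length b - 1\<close> adjacent pairs, those that are neither 0-pairs nor 1-pairs are the changes
  of bit, and the first and last bits agree iff the number of changes is even.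
\<close>

lemma hd_eq_last_iff:
  assumes "b \<noteq> []" "set b \<subseteq> {0, 1}"
  shows "hd b = last b \<longleftrightarrow> odd (length b + pairs 0 b + pairs 1 b)"
  using assms
proof (induction b rule: induct_list012)
  case (3 x y xs)
  have "last (y # xs) \<in> {0, 1}"
    using "3.prems" last_in_set[of "y # xs"] by (metis list.distinct(1) set_subset_Cons subsetD)
  moreover have "y = last (y # xs) \<longleftrightarrow> odd (length (y # xs) + pairs 0 (y # xs) + pairs 1 (y # xs))"
    using "3.IH"(2) "3.prems" by simp
  ultimately show ?case
    using "3.prems" by auto
qed auto

lemma finite_binary_strings: "finite (binary_strings n)"
  unfolding binary_strings_def using finite_lists_length_eq[of "{0, 1::nat}" n]
  by (simp add: conj_commute)

lemma odd_imp_S_circ_empty: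
  assumes "n \<ge> 1" "odd (n + k + m)"
  shows "S_circ n k m = {}"
proof -
  have False if b: "b \<in> S_circ n k m" for b
  proof -
    have bin: "b \<noteq> []" "set b \<subseteq> {0, 1}" and len: "length b = n"
      and circ: "circular_pairs 0 b = k" "circular_pairs 1 b = m"
      using b assms(1) by (auto simp: S_circ_def binary_strings_def)
    have "hd b \<in> {0, 1}" "last b \<in> {0, 1}"
      using bin hd_in_set[of b] last_in_set[of b] by blast+
    then show False
      using hd_eq_last_iff[OF bin] assms(2) circ bin(1) len
      by (auto simp: circular_pairs_def split: if_splits)
  qed
  then show ?thesis by blast
qed

lemma card_S_circ_hd_0:
  assumes "n \<ge> 1" "even (n + k + m)"
  shows "card {b \<in> S_circ n k m. hd b = 0} = z (int n) (int k) (int m) + z (int n) (int k - 1) (int m)"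
proof -
  \<comment> \<open>The strings ending in 0; there are none when \<open>k = 0\<close>, as the wrap-around pair is a 0-pair.\<close>
  define E where "E = (if k = 0 then {} else Z n (k - 1) m)"
  have mem: "b \<in> S_circ n k m \<and> hd b = 0 \<longleftrightarrow> b \<in> Z n k m \<union> E" for b
  proof (cases "b \<in> binary_strings n")
    case True
    then have bin: "b \<noteq> []" "set b \<subseteq> {0, 1}" and len: "length b = n"
      using assms(1) by (auto simp: binary_strings_def)
    have "last b \<in> {0, 1}"
      using bin last_in_set[of b] by blast
    then show ?thesis
      using hd_eq_last_iff[OF bin] assms(2) bin(1) len True
      by (cases k) (auto simp: E_def S_circ_def Z_def circular_pairs_def split: if_splits)
  qed (auto simp: E_def S_circ_def Z_def split: if_splits)
  have "finite (Z n k m)" "finite E"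
    using finite_binary_strings[of n] by (auto simp: E_def Z_def)
  moreover have "Z n k m \<inter> E = {}"
    by (auto simp: E_def Z_def split: if_splits)
  ultimately have "card (Z n k m \<union> E) = card (Z n k m) + card E"
    by (rule card_Un_disjoint)
  moreover have "card E = z (int n) (int k - 1) (int m)"
    by (cases k) (auto simp: E_def z_def)
  moreover have "{b \<in> S_circ n k m. hd b = 0} = Z n k m \<union> E"
    using mem by blast
  ultimately show ?thesis by (simp add: z_def)
qed

definition complement :: "nat list \<Rightarrow> nat list" where
  "complement = map (\<lambda>x. 1 - x)"

lemma complement_complement: "set b \<subseteq> {0, 1} \<Longrightarrow> complement (complement b) = b"
  unfolding complement_def by (induction b) auto

lemma pairs_complement:
  assumes "set b \<subseteq> {0, 1}" "c \<in> {0, 1}"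
  shows "pairs c (complement b) = pairs (1 - c) b"
  using assms unfolding complement_def
proof (induction b rule: induct_list012)
  case 1
  then show ?case by (simp add: pairs_def)
qed auto

lemma circular_pairs_complement:
  assumes "set b \<subseteq> {0, 1}" "c \<in> {0, 1}"
  shows "circular_pairs c (complement b) = circular_pairs (1 - c) b"
proof (cases "b = []")
  case False
  then have "hd b \<in> {0, 1}" "last b \<in> {0, 1}"
    using assms(1) hd_in_set[of b] last_in_set[of b] by blast+
  moreover have "hd (complement b) = 1 - hd b" "last (complement b) = 1 - last b"
    "complement b \<noteq> []"
    using False by (auto simp: complement_def hd_map last_map)
  ultimately show ?thesis
    using assms(2) False by (auto simp: circular_pairs_def pairs_complement[OF assms])
qed (simp add: circular_pairs_def pairs_def complement_def)

lemma complement_S_circ: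
  assumes "n \<ge> 1" "b \<in> S_circ n k m"
  shows "complement b \<in> S_circ n m k" "hd (complement b) = 1 - hd b" "hd b \<in> {0, 1}"
    "complement (complement b) = b"
proof -
  have b: "set b \<subseteq> {0, 1}" "b \<noteq> []"
    using assms by (auto simp: S_circ_def binary_strings_def)
  show "complement b \<in> S_circ n m k"
    using assms(2) b(1) circular_pairs_complement[OF b(1), of 0]
      circular_pairs_complement[OF b(1), of 1]
    by (auto simp: S_circ_def binary_strings_def complement_def)
  show "hd (complement b) = 1 - hd b"
    using b(2) by (simp add: complement_def hd_map)
  show "hd b \<in> {0, 1}"
    using b hd_in_set[of b] by blast
  show "complement (complement b) = b"
    using b(1) by (rule complement_complement)
qed

lemma card_S_circ_hd_1:
  assumes "n \<ge> 1"
  shows "card {b \<in> S_circ n k m. hd b = 1} = card {b \<in> S_circ n m k. hd b = 0}"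
proof (rule bij_betw_same_card)
  show "bij_betw complement {b \<in> S_circ n k m. hd b = 1} {b \<in> S_circ n m k. hd b = 0}"
    by (rule bij_betw_byWitness[where f' = complement])
      (use complement_S_circ[OF assms] in auto)
qed

theorem mainTheorem1:
  fixes n k m :: nat
  assumes "n \<ge> 1"
  shows "card (S_circ n k m) =
    (if odd (n + k + m) then 0
     else z (int n) (int k) (int m) + z (int n) (int k - 1) (int m)
        + z (int n) (int m) (int k) + z (int n) (int m - 1) (int k))"
proof (cases "odd (n + k + m)")
  case True
  then show ?thesis using odd_imp_S_circ_empty[OF assms True] by simp
next
  case False
  let ?A = "\<lambda>c. {b \<in> S_circ n k m. hd b = c}"
  have "finite (S_circ n k m)"
    using finite_binary_strings[of n] by (auto simp: S_circ_def)
  then have "card (?A 0 \<union> ?A 1) = card (?A 0) + card (?A 1)"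
    by (intro card_Un_disjoint) auto
  moreover have "S_circ n k m = ?A 0 \<union> ?A 1"
    using complement_S_circ(3)[OF assms] by blast
  moreover have "card (?A 0) = z (int n) (int k) (int m) + z (int n) (int k - 1) (int m)"
    using card_S_circ_hd_0[OF assms] False by simp
  moreover have "card (?A 1) = z (int n) (int m) (int k) + z (int n) (int m - 1) (int k)"
    using card_S_circ_hd_1[OF assms] card_S_circ_hd_0[OF assms, of m k] False by (simp add: ac_simps)
  ultimately show ?thesis using False by simp
qed

end
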